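(* Let $K\ge 1$, $C>K$ and $1\le Q_S<Q$ be integers, let $\epsilon\in(0,1)$, and let $G(\Delta u)\in(0,\tfrac12)$ be a constant. Consider the Markov chain approximation of the trial and error (TE) dynamics described in the context, with parameters such that its transition probabilities are at most $1$. Let $\bar T_{SE}$ be the expected number of iterations needed to reach the satisfaction equilibrium state for the first time, starting from the state in which no player is satisfied. Then $$\bar T_{SE}\le \frac{CQ/Q_S}{\epsilon^{1+G(\Delta u)}(C-K)}\left(1+\log\left(\frac{K(C-K+1)}{C+1}\right)\right),$$ $$\bar T_{SE}\ge \frac{CQ/Q_S}{\epsilon^{1+G(\Delta u)}(C-K)}\left(\gamma+\log\left(\frac{K(C-K)}{C}\right)\right),$$ where $\gamma\simeq 0.577$ is the Euler-Mascheroni constant.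
   Context: There are $K$ players, $C$ orthogonal channels and $Q$ power quantization levels, so each player has $CQ$ actions; $\epsilon$ is the experimentation probability of the algorithm. $Q_S$ is the number of power levels with which a player achieves the required signal to interference plus noise ratio on any free channel. The approximating discrete-time Markov chain has states indexed by the number $k\in\{0,1,\dots,K\}$ of satisfied players; state $k=K$ is the satisfaction equilibrium (SE). While the SE has not been reached, the only possible change of state is $k\to k+1$ ($0\le k\le K-1$), which occurs at each iteration with probability $$(K-k)\,Q_S\,\frac{C-k}{CQ}\,\epsilon^{1+G(\Delta u)},$$ and otherwise the chain stays at $k$. $\log$ is the natural logarithm. *)

theory Defs
  imports "HOL-Probability.Probability"
begin

text \<open>A time-homogeneous discrete-time Markov chain \<open>X\<close> with (discrete) state space \<open>S\<close> and
  one-step transition distributions \<open>\<kappa> x\<close>, realised on the probability space \<open>M\<close>. The initial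
  distribution is left open.\<close>

definition markov_chain ::
  "'a measure \<Rightarrow> 's set \<Rightarrow> ('s \<Rightarrow> 's pmf) \<Rightarrow> (nat \<Rightarrow> 'a \<Rightarrow> 's) \<Rightarrow> bool" where
  "markov_chain M S \<kappa> X \<longleftrightarrow>
     prob_space M \<and>
     (\<forall>n. X n \<in> measurable M (count_space S)) \<and>
     (\<forall>x\<in>S. set_pmf (\<kappa> x) \<subseteq> S) \<and>
     (\<forall>n h. \<forall>y\<in>S. \<P>(\<omega> in M. \<forall>i\<le>n. X i \<omega> = h i) > 0 \<longrightarrow>
        \<P>(\<omega> in M. X (Suc n) \<omega> = y \<bar> \<forall>i\<le>n. X i \<omega> = h i) = pmf (\<kappa> (h n)) y)"

text \<open>The first time at which \<open>X\<close> is in state \<open>s\<close>; it is \<open>\<infinity>\<close> on paths that never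
  visit \<open>s\<close>, since \<open>Inf {} = \<infinity>\<close> in \<^typ>\<open>enat\<close>.\<close>

definition first_hitting_time :: "(nat \<Rightarrow> 'a \<Rightarrow> 's) \<Rightarrow> 's \<Rightarrow> 'a \<Rightarrow> enat" where
  "first_hitting_time X s \<omega> = Inf {enat n |n. X n \<omega> = s}"

definition expected_hitting_time ::
  "'a measure \<Rightarrow> (nat \<Rightarrow> 'a \<Rightarrow> 's) \<Rightarrow> 's \<Rightarrow> ennreal" where
  "expected_hitting_time M X s =
     (\<integral>\<^sup>+ \<omega>. ennreal_of_enat (first_hitting_time X s \<omega>) \<partial>M)"

definition te_step_prob ::
  "nat \<Rightarrow> nat \<Rightarrow> nat \<Rightarrow> nat \<Rightarrow> real \<Rightarrow> real \<Rightarrow> nat \<Rightarrow> real" where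
  "te_step_prob K C Q QS \<epsilon> G k =
     (real K - real k) * real QS * ((real C - real k) / (real C * real Q)) * \<epsilon> powr (1 + G)"

text \<open>The behaviour after the satisfaction equilibrium \<open>K\<close> has been reached is irrelevant for the
  first hitting time, so the row \<open>\<kappa> K\<close> is left unconstrained (absorption is one possibility).\<close>

definition te_chain ::
  "nat \<Rightarrow> nat \<Rightarrow> nat \<Rightarrow> nat \<Rightarrow> real \<Rightarrow> real \<Rightarrow> 'a measure \<Rightarrow> (nat \<Rightarrow> 'a \<Rightarrow> nat) \<Rightarrow> bool" where
  "te_chain K C Q QS \<epsilon> G M X \<longleftrightarrow>
     (\<exists>\<kappa>. markov_chain M {0..K} \<kappa> X \<and>
       (\<forall>k<K. pmf (\<kappa> k) (Suc k) = te_step_prob K C Q QS \<epsilon> G k \<and>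
              pmf (\<kappa> k) k = 1 - te_step_prob K C Q QS \<epsilon> G k))"

end

theory Submission
  imports Defs
begin

text \<open>The number of visits to each state \<open>k < K\<close> before absorption is geometric with mean
  \<open>1 / p k\<close>, where \<open>p k\<close> is the step probability, so the expected absorption time is
  \<open>\<Sum>k<K. 1 / p k\<close>. By partial fractions
  \<open>(C - K) / ((K - k) (C - k)) = 1 / (K - k) - 1 / (C - k)\<close> this sum is a multiple of
  \<open>H K - (H C - H (C - K))\<close>, where \<open>H\<close> denotes harmonic numbers, and the two bounds follow from
  logarithmic estimates of \<open>H K\<close> and of \<open>H C - H (C - K)\<close>.\<close>

section \<open>Hitting times as tail sums\<close>

lemma first_hitting_time_gt_iff:
  "enat n < first_hitting_time X s \<omega> \<longleftrightarrow> (\<forall>i\<le>n. X i \<omega> \<noteq> s)"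
proof
  assume "enat n < first_hitting_time X s \<omega>"
  moreover have "first_hitting_time X s \<omega> \<le> enat i" if "X i \<omega> = s" for i
    unfolding first_hitting_time_def using that by (intro Inf_lower) auto
  ultimately show "\<forall>i\<le>n. X i \<omega> \<noteq> s"
    by (metis enat_ord_simps(1) leD order_trans)
next
  assume "\<forall>i\<le>n. X i \<omega> \<noteq> s"
  then have "enat (Suc n) \<le> first_hitting_time X s \<omega>"
    unfolding first_hitting_time_def by (auto intro!: Inf_greatest simp: not_less_eq_eq[symmetric])
  then show "enat n < first_hitting_time X s \<omega>"
    by (meson enat_ord_simps(2) lessI less_le_trans)
qed

text \<open>This is the tail formula, summing the probabilities of \<open>T > n\<close> over
  \<open>n\<close>. It also covers hitting times that are infinite with positive
  probability.\<close>

lemma expected_hitting_time_eq_suminf: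
  assumes [measurable]: "\<And>n. X n \<in> measurable M (count_space S)"
  shows "expected_hitting_time M X s = (\<Sum>n. emeasure M {\<omega> \<in> space M. \<forall>i\<le>n. X i \<omega> \<noteq> s})"
proof -
  have [measurable]: "Measurable.pred M (\<lambda>\<omega>. enat n < first_hitting_time X s \<omega>)" for n
    unfolding first_hitting_time_gt_iff by measurable
  have fin: "Measurable.pred M (\<lambda>\<omega>. first_hitting_time X s \<omega> = enat n)" for n
  proof -
    have "first_hitting_time X s \<omega> = enat n \<longleftrightarrow>
        \<not> enat n < first_hitting_time X s \<omega> \<and> (\<forall>m<n. enat m < first_hitting_time X s \<omega>)" for \<omega>
      by (cases "first_hitting_time X s \<omega>") (auto intro: le_antisym leI)
    then show ?thesis by simp
  qed
  have inf: "Measurable.pred M (\<lambda>\<omega>. first_hitting_time X s \<omega> = \<infinity>)"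
  proof -
    have "first_hitting_time X s \<omega> = \<infinity> \<longleftrightarrow> (\<forall>m. enat m < first_hitting_time X s \<omega>)" for \<omega>
      by (cases "first_hitting_time X s \<omega>") auto
    then show ?thesis by simp
  qed
  \<comment> \<open>Since \<open>enat\<close> is countable, measurability can be checked on single
    points.\<close>
  have "Measurable.pred M (\<lambda>\<omega>. first_hitting_time X s \<omega> = t)" for t
    using fin inf by (cases t) auto
  then have "first_hitting_time X s \<in> measurable M (count_space UNIV)"
    by (subst measurable_count_space_eq2_countable)
       (auto simp: vimage_def pred_def Int_def conj_commute)
  from nn_integral_enat_function[OF this] show ?thesis
    unfolding expected_hitting_time_def first_hitting_time_gt_iff .
qed

section \<open>One-step transitions of the chain\<close>

text \<open>\<open>markov_chain\<close> conditions on one full path prefix. Finiteness of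
  \<open>A\<close> leaves finitely many prefixes through \<open>A\<close> ending in
  \<open>j\<close>; all of them have the same transition probability to \<open>y\<close>, which
  factors out of the sum.\<close>

lemma markov_chain_step_in_set:
  assumes mc: "markov_chain M S \<kappa> X" and "finite A" and y: "y \<in> S"
  shows "\<P>(\<omega> in M. (\<forall>i\<le>n. X i \<omega> \<in> A) \<and> X n \<omega> = j \<and> X (Suc n) \<omega> = y) =
    \<P>(\<omega> in M. (\<forall>i\<le>n. X i \<omega> \<in> A) \<and> X n \<omega> = j) * pmf (\<kappa> j) y"
proof -
  interpret prob_space M using mc by (simp add: markov_chain_def)
  have [measurable]: "\<And>n. X n \<in> measurable M (count_space S)"
    using mc by (simp add: markov_chain_def)
  \<comment> \<open>Extensional functions give each prefix exactly one representative, so the events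
    \<open>E h\<close> are disjoint.\<close>
  define H where "H = {h \<in> {..n} \<rightarrow>\<^sub>E A. h n = j}"
  define E where "E h = {\<omega> \<in> space M. \<forall>i\<le>n. X i \<omega> = h i}" for h
  define F where "F h = {\<omega> \<in> space M. X (Suc n) \<omega> = y \<and> (\<forall>i\<le>n. X i \<omega> = h i)}" for h
  have fin: "finite H"
    unfolding H_def by (rule finite_subset[OF _ finite_PiE[of "{..n}" "\<lambda>_. A"]])
      (use \<open>finite A\<close> in auto)
  have [measurable]: "E h \<in> sets M" "F h \<in> sets M" for h
    unfolding E_def F_def by measurable
  have path: "\<exists>h\<in>H. \<forall>i\<le>n. X i \<omega> = h i" if "\<forall>i\<le>n. X i \<omega> \<in> A" "X n \<omega> = j" for \<omega>
    by (rule bexI[of _ "restrict (\<lambda>i. X i \<omega>) {..n}"]) (use that in \<open>auto simp: H_def\<close>)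
  have EF: "F h \<subseteq> E h" for h
    by (auto simp: E_def F_def)
  have disjE: "disjoint_family_on E H"
    unfolding disjoint_family_on_def
  proof (intro ballI impI)
    fix g h assume gh: "g \<in> H" "h \<in> H" "g \<noteq> h"
    then have "\<exists>i\<le>n. g i \<noteq> h i"
      unfolding H_def by (metis (no_types, lifting) PiE_ext atMost_iff mem_Collect_eq)
    then show "E g \<inter> E h = {}" by (force simp: E_def)
  qed
  then have disjF: "disjoint_family_on F H"
    using EF by (fastforce simp: disjoint_family_on_def)
  have step: "prob (F h) = prob (E h) * pmf (\<kappa> j) y" if "h \<in> H" for h
  \<comment> \<open>The Markov property says nothing about null prefixes; for them both sides
    vanish.\<close>
  proof (cases "prob (E h) = 0")
    case True
    moreover have "prob (F h) \<le> prob (E h)"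
      using EF by (intro finite_measure_mono) auto
    ultimately show ?thesis by (simp add: measure_le_0_iff)
  next
    case False
    then have "prob (E h) > 0" by (simp add: zero_less_measure_iff)
    then have "prob (F h) / prob (E h) = pmf (\<kappa> (h n)) y"
      using mc y unfolding markov_chain_def cond_prob_def E_def F_def by blast
    then show ?thesis using False that by (simp add: field_simps H_def)
  qed
  have "{\<omega> \<in> space M. (\<forall>i\<le>n. X i \<omega> \<in> A) \<and> X n \<omega> = j \<and> X (Suc n) \<omega> = y} = (\<Union>h\<in>H. F h)"
    using path by (fastforce simp: F_def H_def PiE_def Pi_def)
  moreover have "{\<omega> \<in> space M. (\<forall>i\<le>n. X i \<omega> \<in> A) \<and> X n \<omega> = j} = (\<Union>h\<in>H. E h)"
    using path by (fastforce simp: E_def H_def PiE_def Pi_def)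
  ultimately show ?thesis
    using fin disjE disjF step
    by (simp add: finite_measure_finite_Union image_subset_iff sum_distrib_right)
qed

text \<open>Two points that carry all the mass leave none for a third. This rules out every
  transition except staying and moving up.\<close>

lemma pmf_eq_0_outside_pair:
  assumes "x \<noteq> y" and "pmf p x + pmf p y = 1" and "z \<noteq> x" and "z \<noteq> y"
  shows "pmf p z = 0"
proof -
  have "pmf p x + (pmf p y + pmf p z) = measure_pmf.prob p {x, y, z}"
    using assms by (simp add: measure_measure_pmf_finite)
  also have "\<dots> \<le> 1" by (rule measure_pmf.prob_le_1)
  finally show ?thesis using assms(2) pmf_nonneg[of p z] by linarith
qed

section \<open>Expected occupation times of a pure birth chain\<close>

text \<open>Here \<open>a n k\<close> stands for the probability of being in \<open>k\<close> at
  time \<open>n\<close> before absorption, so its sum over \<open>n\<close> is the expected time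
  spent in \<open>k\<close>.\<close>

lemma pure_birth_sums:
  fixes a :: "nat \<Rightarrow> nat \<Rightarrow> real" and p :: "nat \<Rightarrow> real"
  assumes init: "\<And>k. k < K \<Longrightarrow> a 0 k = (if k = 0 then 1 else 0)"
    and nonneg: "\<And>n k. 0 \<le> a n k"
    and zero: "\<And>n. 0 < K \<Longrightarrow> a (Suc n) 0 = a n 0 * (1 - p 0)"
    and Suc: "\<And>n k. Suc k < K \<Longrightarrow> a (Suc n) (Suc k) = a n (Suc k) * (1 - p (Suc k)) + a n k * p k"
    and pos: "\<And>k. k < K \<Longrightarrow> 0 < p k"
    and "k < K"
  shows "(\<lambda>n. a n k) sums (1 / p k)"
proof -
  text \<open>Every state receives a total inflow of \<open>1\<close>: the initial mass for \<open>0\<close>, and the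
    total flow out of the predecessor otherwise.\<close>
  have key: "(\<lambda>n. b n) sums (1 / q)"
    if q: "0 < q" and b: "\<And>n. 0 \<le> b n" and c: "\<And>n. 0 \<le> c n" "c sums s" "b 0 + s = 1"
      and rec: "\<And>n. b (Suc n) = b n * (1 - q) + c n" for q s :: real and b c
  proof -
    \<comment> \<open>Mass balance up to time \<open>N\<close>: outflow equals inflow minus what is
      still present. Boundedness of the partial sums will give \<open>b N\<close> tending to 0,
      leaving total outflow 1.\<close>
    have part: "q * (\<Sum>n<N. b n) = b 0 + (\<Sum>n<N. c n) - b N" for N
      by (induction N) (auto simp: rec algebra_simps)
    have "(\<Sum>n<N. b n) \<le> 1 / q" for N
    proof -
      have "(\<Sum>n<N. c n) \<le> s" using c by (metis sum_le_suminf sums_iff finite_lessThan)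
      then have "q * (\<Sum>n<N. b n) \<le> 1" using part[of N] b[of N] c(3) by linarith
      then show ?thesis using q by (simp add: field_simps)
    qed
    then have "summable b" by (intro summableI_nonneg_bounded b)
    then have "b \<longlonglongrightarrow> 0" by (rule summable_LIMSEQ_zero)
    then have "(\<lambda>N. (b 0 + (\<Sum>n<N. c n) - b N) / q) \<longlonglongrightarrow> (b 0 + s - 0) / q"
      using c(2) q by (intro tendsto_intros) (auto simp: sums_def)
    moreover have "(b 0 + (\<Sum>n<N. c n) - b N) / q = (\<Sum>n<N. b n)" for N
      using part[of N] q by (simp add: field_simps)
    ultimately show ?thesis using c(3) by (simp add: sums_def)
  qed
  show ?thesis using \<open>k < K\<close>
  proof (induction k)
    case 0
    then show ?case
      by (intro key[where c = "\<lambda>_. 0" and s = 0]) (auto simp: init nonneg zero pos)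
  next
    case (Suc k)
    then have "(\<lambda>n. a n k * p k) sums (1 / p k * p k)" by (intro sums_mult2) auto
    then have "(\<lambda>n. a n k * p k) sums 1" using pos[of k] Suc.prems by simp
    then show ?case using Suc.prems pos[of k]
      by (intro key[where c = "\<lambda>n. a n k * p k" and s = 1])
         (auto simp: init nonneg assms(4) pos less_imp_le)
  qed
qed

text \<open>The event of not having reached \<open>K\<close> by time \<open>n\<close> splits by the
  current state, which turns the tail formula into a sum of expected occupation times.\<close>

theorem expected_hitting_time_pure_birth:
  fixes p :: "nat \<Rightarrow> real"
  assumes mc: "markov_chain M {0..K} \<kappa> X"
    and up: "\<And>k. k < K \<Longrightarrow> pmf (\<kappa> k) (Suc k) = p k"
    and stay: "\<And>k. k < K \<Longrightarrow> pmf (\<kappa> k) k = 1 - p k"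
    and pos: "\<And>k. k < K \<Longrightarrow> 0 < p k"
    and start: "AE \<omega> in M. X 0 \<omega> = 0"
  shows "expected_hitting_time M X K = ennreal (\<Sum>k<K. 1 / p k)"
proof -
  interpret prob_space M using mc by (simp add: markov_chain_def)
  have X [measurable]: "\<And>n. X n \<in> measurable M (count_space {0..K})"
    using mc by (simp add: markov_chain_def)
  have le: "X n \<omega> \<le> K" if "\<omega> \<in> space M" for n \<omega>
    using measurable_space[OF X that] by simp
  \<comment> \<open>The row \<open>\<kappa> K\<close> is unconstrained, so a path may leave
    \<open>K\<close> again; hence only paths that have stayed below \<open>K\<close> throughout are
    counted.\<close>
  define a where "a n k = \<P>(\<omega> in M. (\<forall>i\<le>n. X i \<omega> \<in> {..<K}) \<and> X n \<omega> = k)" for n k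
  have other: "pmf (\<kappa> j) k = 0" if "j < K" "k \<noteq> j" "k \<noteq> Suc j" for j k
    using that up stay by (intro pmf_eq_0_outside_pair[of j "Suc j"]) auto
  have rec: "a (Suc n) k = (\<Sum>j<K. a n j * pmf (\<kappa> j) k)" if "k < K" for n k
  proof -
    let ?D = "\<lambda>j. {\<omega> \<in> space M. (\<forall>i\<le>n. X i \<omega> \<in> {..<K}) \<and> X n \<omega> = j \<and> X (Suc n) \<omega> = k}"
    have "{\<omega> \<in> space M. (\<forall>i\<le>Suc n. X i \<omega> \<in> {..<K}) \<and> X (Suc n) \<omega> = k} = (\<Union>j<K. ?D j)"
      using that by (auto simp: le_Suc_eq)
    then have "a (Suc n) k = prob (\<Union>j<K. ?D j)" by (simp only: a_def)
    also have "\<dots> = (\<Sum>j<K. prob (?D j))"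
    proof (rule finite_measure_finite_Union)
      show "?D ` {..<K} \<subseteq> sets M" by auto
    qed (auto simp: disjoint_family_on_def)
    also have "\<dots> = (\<Sum>j<K. a n j * pmf (\<kappa> j) k)"
      unfolding a_def using that
      by (intro sum.cong refl markov_chain_step_in_set[OF mc]) auto
    finally show ?thesis .
  qed
  have sums: "(\<lambda>n. a n k) sums (1 / p k)" if "k < K" for k
  proof (rule pure_birth_sums[OF _ _ _ _ pos that])
    fix n k
    show "0 \<le> a n k" by (simp add: a_def)
    show "a 0 k = (if k = 0 then 1 else 0)" if "k < K"
    proof (cases "k = 0")
      case True
      then have "AE \<omega> in M. (\<forall>i\<le>0. X i \<omega> \<in> {..<K}) \<and> X 0 \<omega> = k"
        using start that by auto
      then show ?thesis using True by (simp add: a_def prob_Collect_eq_1)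
    next
      case False
      then have "AE \<omega> in M. \<not> ((\<forall>i\<le>0. X i \<omega> \<in> {..<K}) \<and> X 0 \<omega> = k)"
        using start by auto
      then show ?thesis using False by (simp add: a_def prob_Collect_eq_0)
    qed
    show "a (Suc n) 0 = a n 0 * (1 - p 0)" if "0 < K"
    proof -
      have "a (Suc n) 0 = (\<Sum>j\<in>{0}. a n j * pmf (\<kappa> j) 0)"
        unfolding rec[OF that] using that by (intro sum.mono_neutral_right) (auto simp: other)
      then show ?thesis using stay[OF that] by simp
    qed
    show "a (Suc n) (Suc k) = a n (Suc k) * (1 - p (Suc k)) + a n k * p k" if "Suc k < K"
    proof -
      have "a (Suc n) (Suc k) = (\<Sum>j\<in>{k, Suc k}. a n j * pmf (\<kappa> j) (Suc k))"
        unfolding rec[OF that] using that by (intro sum.mono_neutral_right) (auto simp: other)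
      then show ?thesis using stay[OF that] up[of k] that by simp
    qed
  qed
  have not_hit: "prob {\<omega> \<in> space M. \<forall>i\<le>n. X i \<omega> \<noteq> K} = (\<Sum>k<K. a n k)" for n
  proof -
    let ?D = "\<lambda>k. {\<omega> \<in> space M. (\<forall>i\<le>n. X i \<omega> \<in> {..<K}) \<and> X n \<omega> = k}"
    have "{\<omega> \<in> space M. \<forall>i\<le>n. X i \<omega> \<noteq> K} = (\<Union>k<K. ?D k)"
      using le by (auto simp: le_less)
    then have "prob {\<omega> \<in> space M. \<forall>i\<le>n. X i \<omega> \<noteq> K} = prob (\<Union>k<K. ?D k)" by simp
    also have "\<dots> = (\<Sum>k<K. prob (?D k))"
    proof (rule finite_measure_finite_Union)
      show "?D ` {..<K} \<subseteq> sets M" by auto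
    qed (auto simp: disjoint_family_on_def)
    finally show ?thesis by (simp only: a_def)
  qed
  have "(\<lambda>n. \<Sum>k<K. a n k) sums (\<Sum>k<K. 1 / p k)"
    using sums by (intro sums_sum) auto
  then have "(\<Sum>n. ennreal (\<Sum>k<K. a n k)) = ennreal (\<Sum>k<K. 1 / p k)"
    by (intro suminf_ennreal_eq sum_nonneg) (auto simp: a_def)
  then show ?thesis
    unfolding expected_hitting_time_eq_suminf[OF X] emeasure_eq_measure not_hit .
qed

section \<open>Harmonic numbers and logarithms\<close>

lemma sum_inverse_eq_harm_diff:
  "k \<le> n \<Longrightarrow> (\<Sum>i<k. 1 / (real n - real i)) = harm n - harm (n - k)"
proof (induction k)
  case (Suc k)
  then have "harm (n - k) = harm (n - Suc k) + 1 / (real n - real k)"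
    using harm_Suc[of "n - Suc k", where ?'a = real] by (simp add: Suc_diff_Suc inverse_eq_divide)
  with Suc show ?case by simp
qed simp

text \<open>Telescopes \<open>ln (x + 1) - ln x \<le> 1 / x\<close> over integers \<open>x\<close>.
  The shift by one produces \<open>C - K + 1\<close> and \<open>C + 1\<close> in the upper
  bound.\<close>

lemma harm_diff_ge_ln:
  assumes "m \<le> n"
  shows "ln (real n + 1) - ln (real m + 1) \<le> harm n - harm m"
  using assms
proof (induction n rule: dec_induct)
  case (step n)
  then show ?case
    using ln_diff_le_inverse[of "real n + 1"]
    by (simp add: harm_Suc inverse_eq_divide add_ac)
qed simp

text \<open>The sequence \<open>harm n - ln n\<close> decreases to its limit
  \<open>euler_mascheroni\<close>.\<close>

lemma harm_ge_euler_mascheroni_plus_ln: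
  assumes "n > 0"
  shows "euler_mascheroni + ln (real n) \<le> harm n"
proof -
  have "euler_mascheroni \<le> harm n - ln (real n)"
    by (rule LIMSEQ_le_const2[OF euler_mascheroni_LIMSEQ])
       (use euler_mascheroni_sequence_decreasing[OF assms] in auto)
  then show ?thesis by simp
qed

theorem theorem8:
  fixes K C Q QS :: nat and \<epsilon> G :: real
    and M :: "'a measure" and X :: "nat \<Rightarrow> 'a \<Rightarrow> nat"
  assumes "K \<ge> 1" and "C > K" and "1 \<le> QS" and "QS < Q"
    and "0 < \<epsilon>" and "\<epsilon> < 1"
    and "0 < G" and "G < 1 / 2"
    and "\<forall>k<K. te_step_prob K C Q QS \<epsilon> G k \<le> 1"
    and "te_chain K C Q QS \<epsilon> G M X"
    and "AE \<omega> in M. X 0 \<omega> = 0"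
  shows "enn2ereal (expected_hitting_time M X K) \<le>
           ereal ((real C * real Q / real QS) / (\<epsilon> powr (1 + G) * (real C - real K)) *
             (1 + ln (real K * (real C - real K + 1) / (real C + 1))))
       \<and> enn2ereal (expected_hitting_time M X K) \<ge>
           ereal ((real C * real Q / real QS) / (\<epsilon> powr (1 + G) * (real C - real K)) *
             (euler_mascheroni + ln (real K * (real C - real K) / real C)))"
proof -
  \<comment> \<open>The common prefactor of both bounds; its divisor \<open>C - K\<close> cancels
    the numerator of the partial fraction difference.\<close>
  define c where "c = (real C * real Q / real QS) / (\<epsilon> powr (1 + G) * (real C - real K))"
  have CK: "real K < real C" using \<open>C > K\<close> by simp
  have pos: "0 < \<epsilon> powr (1 + G)" "0 < real C" "0 < real Q" "0 < real QS"
    using assms by auto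
  then have c: "0 \<le> c" using CK by (simp add: c_def)
  obtain \<kappa> where "markov_chain M {0..K} \<kappa> X"
    and "\<And>k. k < K \<Longrightarrow> pmf (\<kappa> k) (Suc k) = te_step_prob K C Q QS \<epsilon> G k"
    and "\<And>k. k < K \<Longrightarrow> pmf (\<kappa> k) k = 1 - te_step_prob K C Q QS \<epsilon> G k"
    using assms(10) by (auto simp: te_chain_def)
  moreover have "0 < te_step_prob K C Q QS \<epsilon> G k" if "k < K" for k
    using that CK pos by (simp add: te_step_prob_def)
  ultimately have T: "expected_hitting_time M X K = ennreal (\<Sum>k<K. 1 / te_step_prob K C Q QS \<epsilon> G k)"
    using expected_hitting_time_pure_birth assms(11) by blast
  have "1 / te_step_prob K C Q QS \<epsilon> G k = c * (1 / (real K - real k) - 1 / (real C - real k))"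
    if "k < K" for k
  proof -
    have "real K - real k > 0" "real C - real k > 0" "real C - real K > 0" using that CK by auto
    with pos show ?thesis by (simp add: te_step_prob_def c_def divide_simps)
  qed
  then have "(\<Sum>k<K. 1 / te_step_prob K C Q QS \<epsilon> G k) =
      c * ((\<Sum>k<K. 1 / (real K - real k)) - (\<Sum>k<K. 1 / (real C - real k)))"
    by (simp add: sum_distrib_left[symmetric] sum_subtractf)
  also have "\<dots> = c * (harm K - (harm C - harm (C - K)))"
    using \<open>C > K\<close> by (simp add: sum_inverse_eq_harm_diff harm_def)
  finally have sum: "(\<Sum>k<K. 1 / te_step_prob K C Q QS \<epsilon> G k) = c * (harm K - (harm C - harm (C - K)))" .
  \<comment> \<open>Nonnegativity is required because \<open>ennreal\<close> sends negative reals to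
    0.\<close>
  have "(\<Sum>k<K. 1 / te_step_prob K C Q QS \<epsilon> G k) \<ge> 0"
    using CK pos by (intro sum_nonneg) (simp add: te_step_prob_def)
  then have T': "enn2ereal (expected_hitting_time M X K) = ereal (c * (harm K - (harm C - harm (C - K))))"
    unfolding T sum by (simp add: enn2ereal_ennreal)
  \<comment> \<open>The decreasing sequence \<open>harm n - ln n\<close> has value 1 at
    \<open>n = 1\<close>.\<close>
  have "harm K \<le> 1 + ln (real K)"
    using euler_mascheroni_sequence_decreasing[of 1 K] \<open>K \<ge> 1\<close> by (simp add: harm_expand)
  moreover have "ln (real C + 1) - ln (real C - real K + 1) \<le> harm C - harm (C - K)"
    using harm_diff_ge_ln[of "C - K" C] CK by (simp add: of_nat_diff)
  ultimately have upper: "harm K - (harm C - harm (C - K)) \<le>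
      1 + ln (real K * (real C - real K + 1) / (real C + 1))"
    using CK \<open>K \<ge> 1\<close> by (simp add: ln_mult ln_div)
  \<comment> \<open>Comparing the same sequence at \<open>C - K\<close>, which is positive, and at
    \<open>C\<close> gives the unshifted logarithms of the lower bound.\<close>
  have "harm C - harm (C - K) \<le> ln (real C) - ln (real C - real K)"
    using euler_mascheroni_sequence_decreasing[of "C - K" C] CK by (simp add: of_nat_diff)
  with harm_ge_euler_mascheroni_plus_ln[of K]
  have lower: "euler_mascheroni + ln (real K * (real C - real K) / real C) \<le>
      harm K - (harm C - harm (C - K))"
    using CK \<open>K \<ge> 1\<close> by (simp add: ln_mult ln_div)
  show ?thesis
    unfolding T' c_def[symmetric] using c upper lower by (simp add: mult_left_mono)
qed

end
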